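(* Let $\mathcal{Z}$ be a finite set with a distinguished element $0\in\mathcal{Z}$, $E=\prod_{z\in\mathcal{Z}}(L_z,U_z)$ a product of $|\mathcal{Z}|$ intervals of the real line, $c\in\mathbb{R}$, $\Lambda=\{q\in\mathbb{R}^{|\mathcal{Z}|}:\sum_{z\in\mathcal{Z}}q_z=c\}$, $q\in\Lambda$, and let $Q:E\to\Lambda$ be a continuous function satisfying: (a) weak substitutes; (b) the pivotal substitutes property around $q$; (c) for all $x\in\mathcal{Z}$, $Q$ is responsive to $x$ around $q_x$; (d) one can order $\mathcal{Z}=\{z_1=0,z_2,\dots,z_{|\mathcal{Z}|}\}$ so that for each $k\ge2$ there is a function $\bar Q_{z_k}$ on $E$ with $Q_{z_k}(p)\le\bar Q_{z_k}(p)$ for all $p\in E$, where $\bar Q_{z_k}(p)$ does not depend on $p_{z_{k+1}},\dots,p_{z_{|\mathcal{Z}|}}$ and is downward responsive around $q$ (i.e. $\lim_{p_{z_k}\to L_{z_k}}\bar Q_{z_k}(p)<q_{z_k}$, the other coordinates being fixed); (e) connected strict substitutes. Let $\psi:\mathbb{R}^{|\mathcal{Z}|}\to\mathbb{R}$ be a normalization mapping (with bounds $L_\psi,U_\psi$), and assume that $p_z<p_z'$ for all $z\in\mathcal{Z}$ implies $\psi(p)<\psi(p')$. Then, for any $K\in(L_\psi,U_\psi)$, the dichotomy algorithm described in the context converges to the unique solution of the system $$Q(p)=q,\qquad\psi(p)=K.$$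
   Context: The bounds satisfy $-\infty\le L_z<U_z\le+\infty$. Dichotomy algorithm. For $\pi\in(L_0,U_0)$ let $p^*(\pi)\in E$ denote the solution of $Q(p^* )=q$ with $p_0^*=\pi$ (under the hypotheses it exists and is unique). Step $0$: pick $\underline{p}_0\in(L_0,U_0)$ small enough that $\psi(p^*(\underline{p}_0))\le K$ and $\bar p_0\in(L_0,U_0)$ large enough that $\psi(p^*(\bar p_0))\ge K$; set $\underline{p}_0^0=\underline{p}_0$, $\bar p_0^0=\bar p_0$, $p_0^0=\bar p_0^0$. Step $t\ge1$: set $p_0^t=(\bar p_0^{t-1}+\underline{p}_0^{t-1})/2$ and compute $p^*=p^*(p_0^t)$. If $\psi(p^* )\le K$, set $\underline{p}_0^t=p_0^t$ and $\bar p_0^t=\bar p_0^{t-1}$; if $\psi(p^* )\ge K$, set $\underline{p}_0^t=\underline{p}_0^{t-1}$ and $\bar p_0^t=p_0^t$ (when $\psi(p^* )=K$ the solution has been reached, and either update may be used). The algorithm is stopped when $|\bar p_0^t-\underline{p}_0^t|<\epsilon$ for a sufficiently small $\epsilon>0$; convergence means that, without the stopping rule, the iterates $p^*(p_0^t)$ converge to the solution as $t\to\infty$. Weak substitutes: for all $x\ne y$ in $\mathcal{Z}$, $Q_x(p)$ is nondecreasing in $p_x$ and nonincreasing in $p_y$. Pivotal substitutes around $q$: $Q$ has the downward (resp. upward) pivotal substitutes property around $q$ if for every nonempty proper subset $\mathcal{X}\subset\mathcal{Z}$ and every fixed value of $(p_x)_{x\in\mathcal{X}}$, the sum $\sum_{x\in\mathcal{X}}Q_x(p)$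 becomes (i.e. eventually is) strictly smaller (resp. strictly larger) than $\sum_{x\in\mathcal{X}}q_x$ as every $p_z$, $z\notin\mathcal{X}$, tends to its upper bound $U_z$ (resp. to its lower bound $L_z$). It has the pivotal substitutes property around $q$ if it has both. Responsiveness: $Q$ is upward (resp. downward) responsive to $x$ around $q_x$ if, the other coordinates of $p$ being fixed arbitrarily, $\lim_{p_x\to U_x}Q_x(p)>q_x$ (resp. $\lim_{p_x\to L_x}Q_x(p)<q_x$). It is responsive if it is both. Connected strict substitutes: for every nonempty set $\mathcal{X}\subset\mathcal{Z}$ and all $p,p'\in E$, if $p_x=p'_x$ for $x\in\mathcal{X}$, $p_y\le p'_y$ for $y\notin\mathcal{X}$, and $p\ne p'$, then $\sum_{x\in\mathcal{X}}Q_x(p)>\sum_{x\in\mathcal{X}}Q_x(p')$. Normalization mapping: $\psi:\mathbb{R}^{|\mathcal{Z}|}\to\mathbb{R}$ (i) is continuous; (ii) is weakly increasing in $p_z$ for all $z\in\mathcal{Z}$; (iii) satisfies $\psi(p)\to L_\psi$ when $p_z\to L_z$ for all $z\in\mathcal{Z}$; (iv) satisfies $\psi(p)\to U_\psi$ when $p_z\to U_z$ for all $z\in\mathcal{Z}$; (v) satisfies $\psi(p+t1_{\mathcal{Z}})=\psi(p)+t$ for all $t\in\mathbb{R}$, where $1_{\mathcal{Z}}$ is the all-ones vector. $L_\psi,U_\psi$ may be infinite. *)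

theory Defs
  imports "HOL-Analysis.Analysis"
begin

definition open_box :: "('z::finite \<Rightarrow> ereal) \<Rightarrow> ('z \<Rightarrow> ereal) \<Rightarrow> (real ^ 'z) set" where
  "open_box L U = {p. \<forall>z. L z < ereal (p $ z) \<and> ereal (p $ z) < U z}"

definition hyperplane :: "real \<Rightarrow> (real ^ 'z::finite) set" where
  "hyperplane c = {q. (\<Sum>z\<in>UNIV. q $ z) = c}"

text \<open>
  The coordinates in \<open>Y\<close> tend, jointly and from the inside of the box, to their upper
  (resp. lower) bounds, while the coordinates outside \<open>Y\<close> keep their values in \<open>p0\<close>.
  The bounds may be infinite.
\<close>

definition coords_to_upper ::
    "('z::finite \<Rightarrow> ereal) \<Rightarrow> 'z set \<Rightarrow> real ^ 'z \<Rightarrow> (real ^ 'z) filter" where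
  "coords_to_upper U Y p0 =
     inf (principal {p. \<forall>x. x \<notin> Y \<longrightarrow> p $ x = p0 $ x})
         (INF z\<in>Y. filtercomap (\<lambda>p. ereal (p $ z)) (at_left (U z)))"

definition coords_to_lower ::
    "('z::finite \<Rightarrow> ereal) \<Rightarrow> 'z set \<Rightarrow> real ^ 'z \<Rightarrow> (real ^ 'z) filter" where
  "coords_to_lower L Y p0 =
     inf (principal {p. \<forall>x. x \<notin> Y \<longrightarrow> p $ x = p0 $ x})
         (INF z\<in>Y. filtercomap (\<lambda>p. ereal (p $ z)) (at_right (L z)))"

definition weak_substitutes ::
    "(real ^ 'z::finite) set \<Rightarrow> (real ^ 'z \<Rightarrow> real ^ 'z) \<Rightarrow> bool" where
  "weak_substitutes E Q \<longleftrightarrow>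
     (\<forall>x y. x \<noteq> y \<longrightarrow>
        (\<forall>p\<in>E. \<forall>p'\<in>E. (\<forall>z. z \<noteq> x \<longrightarrow> p $ z = p' $ z) \<and> p $ x \<le> p' $ x
            \<longrightarrow> Q p $ x \<le> Q p' $ x) \<and>
        (\<forall>p\<in>E. \<forall>p'\<in>E. (\<forall>z. z \<noteq> y \<longrightarrow> p $ z = p' $ z) \<and> p $ y \<le> p' $ y
            \<longrightarrow> Q p' $ x \<le> Q p $ x))"

definition downward_pivotal_substitutes ::
    "('z::finite \<Rightarrow> ereal) \<Rightarrow> ('z \<Rightarrow> ereal) \<Rightarrow> (real ^ 'z \<Rightarrow> real ^ 'z) \<Rightarrow> real ^ 'z \<Rightarrow> bool" where
  "downward_pivotal_substitutes L U Q q \<longleftrightarrow>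
     (\<forall>X. X \<noteq> {} \<and> X \<noteq> UNIV \<longrightarrow> (\<forall>p0\<in>open_box L U.
        \<forall>\<^sub>F p in coords_to_upper U (- X) p0. (\<Sum>x\<in>X. Q p $ x) < (\<Sum>x\<in>X. q $ x)))"

definition upward_pivotal_substitutes ::
    "('z::finite \<Rightarrow> ereal) \<Rightarrow> ('z \<Rightarrow> ereal) \<Rightarrow> (real ^ 'z \<Rightarrow> real ^ 'z) \<Rightarrow> real ^ 'z \<Rightarrow> bool" where
  "upward_pivotal_substitutes L U Q q \<longleftrightarrow>
     (\<forall>X. X \<noteq> {} \<and> X \<noteq> UNIV \<longrightarrow> (\<forall>p0\<in>open_box L U.
        \<forall>\<^sub>F p in coords_to_lower L (- X) p0. (\<Sum>x\<in>X. Q p $ x) > (\<Sum>x\<in>X. q $ x)))"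

definition pivotal_substitutes ::
    "('z::finite \<Rightarrow> ereal) \<Rightarrow> ('z \<Rightarrow> ereal) \<Rightarrow> (real ^ 'z \<Rightarrow> real ^ 'z) \<Rightarrow> real ^ 'z \<Rightarrow> bool" where
  "pivotal_substitutes L U Q q \<longleftrightarrow>
     downward_pivotal_substitutes L U Q q \<and> upward_pivotal_substitutes L U Q q"

text \<open>
  Responsiveness is stated for a scalar function \<open>f\<close> and a level \<open>a\<close>, so that it applies both
  to a component of \<open>Q\<close> and to an upper bound of such a component. The limit is taken in the
  extended reals because \<open>f\<close> need not be bounded.
\<close>

definition upward_responsive ::
    "('z::finite \<Rightarrow> ereal) \<Rightarrow> ('z \<Rightarrow> ereal) \<Rightarrow> (real ^ 'z \<Rightarrow> real) \<Rightarrow> 'z \<Rightarrow> real \<Rightarrow> bool" where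
  "upward_responsive L U f x a \<longleftrightarrow>
     (\<forall>p0\<in>open_box L U. \<exists>l. ((\<lambda>p. ereal (f p)) \<longlongrightarrow> l) (coords_to_upper U {x} p0) \<and> ereal a < l)"

definition downward_responsive ::
    "('z::finite \<Rightarrow> ereal) \<Rightarrow> ('z \<Rightarrow> ereal) \<Rightarrow> (real ^ 'z \<Rightarrow> real) \<Rightarrow> 'z \<Rightarrow> real \<Rightarrow> bool" where
  "downward_responsive L U f x a \<longleftrightarrow>
     (\<forall>p0\<in>open_box L U. \<exists>l. ((\<lambda>p. ereal (f p)) \<longlongrightarrow> l) (coords_to_lower L {x} p0) \<and> l < ereal a)"

text \<open>The list \<open>zs\<close> enumerates the index set; it is indexed from 0, so \<open>zs ! 0\<close> is the first element.\<close>

definition sequential_downward_bounds ::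
    "('z::finite \<Rightarrow> ereal) \<Rightarrow> ('z \<Rightarrow> ereal) \<Rightarrow> 'z \<Rightarrow> (real ^ 'z \<Rightarrow> real ^ 'z) \<Rightarrow> real ^ 'z \<Rightarrow> bool" where
  "sequential_downward_bounds L U z0 Q q \<longleftrightarrow>
     (\<exists>zs. distinct zs \<and> set zs = UNIV \<and> zs ! 0 = z0 \<and>
        (\<forall>k. 1 \<le> k \<and> k < length zs \<longrightarrow>
           (\<exists>Qbar :: real ^ 'z \<Rightarrow> real.
              (\<forall>p\<in>open_box L U. Q p $ (zs ! k) \<le> Qbar p) \<and>
              (\<forall>p\<in>open_box L U. \<forall>p'\<in>open_box L U.
                 (\<forall>j\<le>k. p $ (zs ! j) = p' $ (zs ! j)) \<longrightarrow> Qbar p = Qbar p') \<and>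
              downward_responsive L U Qbar (zs ! k) (q $ (zs ! k)))))"

definition connected_strict_substitutes ::
    "(real ^ 'z::finite) set \<Rightarrow> (real ^ 'z \<Rightarrow> real ^ 'z) \<Rightarrow> bool" where
  "connected_strict_substitutes E Q \<longleftrightarrow>
     (\<forall>X. X \<noteq> {} \<longrightarrow> (\<forall>p\<in>E. \<forall>p'\<in>E.
        (\<forall>x\<in>X. p $ x = p' $ x) \<and> (\<forall>y. y \<notin> X \<longrightarrow> p $ y \<le> p' $ y) \<and> p \<noteq> p'
          \<longrightarrow> (\<Sum>x\<in>X. Q p $ x) > (\<Sum>x\<in>X. Q p' $ x)))"

text \<open>
  The last argument of the two filters is irrelevant here, since no coordinate is held fixed.
  The vector \<open>1\<close> is the all-ones vector.
\<close>

definition normalization_mapping ::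
    "('z::finite \<Rightarrow> ereal) \<Rightarrow> ('z \<Rightarrow> ereal) \<Rightarrow> (real ^ 'z \<Rightarrow> real) \<Rightarrow> ereal \<Rightarrow> ereal \<Rightarrow> bool" where
  "normalization_mapping L U \<psi> L\<psi> U\<psi> \<longleftrightarrow>
     continuous_on UNIV \<psi> \<and>
     (\<forall>z p p'. (\<forall>y. y \<noteq> z \<longrightarrow> p $ y = p' $ y) \<and> p $ z \<le> p' $ z \<longrightarrow> \<psi> p \<le> \<psi> p') \<and>
     ((\<lambda>p. ereal (\<psi> p)) \<longlongrightarrow> L\<psi>) (coords_to_lower L UNIV 0) \<and>
     ((\<lambda>p. ereal (\<psi> p)) \<longlongrightarrow> U\<psi>) (coords_to_upper U UNIV 0) \<and>
     (\<forall>p t. \<psi> (p + t *\<^sub>R 1) = \<psi> p + t)"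

definition is_pinned_solution ::
    "(real ^ 'z::finite) set \<Rightarrow> 'z \<Rightarrow> (real ^ 'z \<Rightarrow> real ^ 'z) \<Rightarrow> real ^ 'z \<Rightarrow> real \<Rightarrow> real ^ 'z \<Rightarrow> bool" where
  "is_pinned_solution E z0 Q q \<pi> p \<longleftrightarrow> p \<in> E \<and> Q p = q \<and> p $ z0 = \<pi>"

definition pinned_solution ::
    "(real ^ 'z::finite) set \<Rightarrow> 'z \<Rightarrow> (real ^ 'z \<Rightarrow> real ^ 'z) \<Rightarrow> real ^ 'z \<Rightarrow> real \<Rightarrow> real ^ 'z" where
  "pinned_solution E z0 Q q \<pi> = (THE p. is_pinned_solution E z0 Q q \<pi> p)"

text \<open>
  A run of the dichotomy algorithm without the stopping rule: \<open>lo t\<close> and \<open>hi t\<close> are the bracket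
  after step \<open>t\<close>, \<open>mid t\<close> is the point tried at step \<open>t\<close>, and \<open>ps\<close> maps a value of the
  distinguished coordinate to the solution of \<open>Q p = q\<close> with that coordinate. It is a relation
  rather than a function because the initial bracket is free and because both updates are allowed
  when the target \<open>K\<close> is hit exactly.
\<close>

definition dichotomy_run ::
    "ereal \<Rightarrow> ereal \<Rightarrow> (real \<Rightarrow> real ^ 'z::finite) \<Rightarrow> (real ^ 'z \<Rightarrow> real) \<Rightarrow> real \<Rightarrow>
     (nat \<Rightarrow> real) \<Rightarrow> (nat \<Rightarrow> real) \<Rightarrow> (nat \<Rightarrow> real) \<Rightarrow> bool" where
  "dichotomy_run L0 U0 ps \<psi> K lo hi mid \<longleftrightarrow>
     L0 < ereal (lo 0) \<and> ereal (lo 0) < U0 \<and> \<psi> (ps (lo 0)) \<le> K \<and>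
     L0 < ereal (hi 0) \<and> ereal (hi 0) < U0 \<and> \<psi> (ps (hi 0)) \<ge> K \<and>
     mid 0 = hi 0 \<and>
     (\<forall>t. mid (Suc t) = (hi t + lo t) / 2 \<and>
        (\<psi> (ps (mid (Suc t))) \<le> K \<and> lo (Suc t) = mid (Suc t) \<and> hi (Suc t) = hi t \<or>
         \<psi> (ps (mid (Suc t))) \<ge> K \<and> lo (Suc t) = lo t \<and> hi (Suc t) = mid (Suc t)))"

end

theory Submission
  imports Defs
begin

text \<open>
  Connected strict substitutes make any two distinct solutions of \<open>Q p = q\<close> strictly ordered
  in every coordinate: otherwise their coordinatewise minimum would have total demand
  larger than \<open>c\<close>. Hence a solution is determined by any one of its coordinates, and a monotone
  compactness argument makes it depend continuously on its coordinate at \<open>z0\<close>.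

  The solution with \<open>p $ z0 = \<pi>\<close> is the supremum of all \<open>p\<close> with \<open>p $ z0 = \<pi>\<close> and \<open>Q p $ y \<le> q $ y\<close>
  for \<open>y \<noteq> z0\<close>. Solving the bounds \<open>Qbar\<close> one coordinate after the other provides such a \<open>p\<close>,
  and downward pivotality prevents the supremum from reaching the upper boundary. By pivotality again, as
  \<open>\<pi>\<close> tends to a bound of the coordinate \<open>z0\<close>, all coordinates of the solution tend to their
  bounds, so that \<open>\<psi>\<close> passes through \<open>K\<close> along the path of solutions; there \<open>\<psi>\<close> is strictly
  increasing and continuous, and bisection converges.
\<close>

section \<open>Boundary limits as thresholds, directed sets, and boxes\<close>

text \<open>The index type is finite, so an event for the infimum of the coordinate filters contains
  an intersection of one event per coordinate, and \<open>bounds\<close> turns each of these into an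
  interval ending at \<open>U z\<close>. Outside \<open>Y\<close> the value of \<open>b\<close> is
  arbitrary below \<open>U z\<close>.\<close>

lemma eventually_coords_to_upper_threshold:
  fixes L U :: "'z::finite \<Rightarrow> ereal"
  assumes ev: "eventually P (coords_to_upper U Y p0)" and bounds: "\<And>z. L z < U z"
  obtains b where "\<And>z. b z < U z"
    and "\<And>p. (\<And>x. x \<notin> Y \<Longrightarrow> p $ x = p0 $ x) \<Longrightarrow>
              (\<And>z. z \<in> Y \<Longrightarrow> b z < ereal (p $ z) \<and> ereal (p $ z) < U z) \<Longrightarrow> P p"
proof -
  have "eventually (\<lambda>p. (\<forall>x. x \<notin> Y \<longrightarrow> p $ x = p0 $ x) \<longrightarrow> P p)
      (INF z\<in>Y. filtercomap (\<lambda>p. ereal (p $ z)) (at_left (U z)))"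
    using ev unfolding coords_to_upper_def inf_commute[of "principal _"]
    by (simp add: eventually_inf_principal)
  then obtain R where R: "\<And>z. z \<in> Y \<Longrightarrow>
        eventually (R z) (filtercomap (\<lambda>p. ereal (p $ z)) (at_left (U z)))"
    and RP: "\<And>p. (\<forall>z\<in>Y. R z p) \<Longrightarrow> (\<forall>x. x \<notin> Y \<longrightarrow> p $ x = p0 $ x) \<longrightarrow> P p"
    by (subst (asm) eventually_INF_finite) auto
  have "\<exists>b<U z. z \<in> Y \<longrightarrow> (\<forall>p. b < ereal (p $ z) \<and> ereal (p $ z) < U z \<longrightarrow> R z p)" for z
  proof (cases "z \<in> Y")
    case True
    from R[OF True] obtain T where T: "eventually T (at_left (U z))"
      and TR: "\<And>p. T (ereal (p $ z)) \<Longrightarrow> R z p"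
      by (auto simp: eventually_filtercomap)
    from T obtain b where "b < U z" "\<And>y. b < y \<Longrightarrow> y < U z \<Longrightarrow> T y"
      by (auto simp: eventually_at_left[OF bounds[of z]])
    then show ?thesis using TR by blast
  qed (use bounds in blast)
  then obtain b where "\<And>z. b z < U z"
    and "\<And>z p. z \<in> Y \<Longrightarrow> b z < ereal (p $ z) \<Longrightarrow> ereal (p $ z) < U z \<Longrightarrow> R z p"
    by metis
  then show thesis using RP by (intro that[of b]) auto
qed

lemma eventually_coords_to_lower_threshold:
  fixes L U :: "'z::finite \<Rightarrow> ereal"
  assumes ev: "eventually P (coords_to_lower L Y p0)" and bounds: "\<And>z. L z < U z"
  obtains b where "\<And>z. L z < b z"
    and "\<And>p. (\<And>x. x \<notin> Y \<Longrightarrow> p $ x = p0 $ x) \<Longrightarrow>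
              (\<And>z. z \<in> Y \<Longrightarrow> L z < ereal (p $ z) \<and> ereal (p $ z) < b z) \<Longrightarrow> P p"
proof -
  have "eventually (\<lambda>p. (\<forall>x. x \<notin> Y \<longrightarrow> p $ x = p0 $ x) \<longrightarrow> P p)
      (INF z\<in>Y. filtercomap (\<lambda>p. ereal (p $ z)) (at_right (L z)))"
    using ev unfolding coords_to_lower_def inf_commute[of "principal _"]
    by (simp add: eventually_inf_principal)
  then obtain R where R: "\<And>z. z \<in> Y \<Longrightarrow>
        eventually (R z) (filtercomap (\<lambda>p. ereal (p $ z)) (at_right (L z)))"
    and RP: "\<And>p. (\<forall>z\<in>Y. R z p) \<Longrightarrow> (\<forall>x. x \<notin> Y \<longrightarrow> p $ x = p0 $ x) \<longrightarrow> P p"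
    by (subst (asm) eventually_INF_finite) auto
  have "\<exists>b>L z. z \<in> Y \<longrightarrow> (\<forall>p. L z < ereal (p $ z) \<and> ereal (p $ z) < b \<longrightarrow> R z p)" for z
  proof (cases "z \<in> Y")
    case True
    from R[OF True] obtain T where T: "eventually T (at_right (L z))"
      and TR: "\<And>p. T (ereal (p $ z)) \<Longrightarrow> R z p"
      by (auto simp: eventually_filtercomap)
    from T obtain b where "L z < b" "\<And>y. L z < y \<Longrightarrow> y < b \<Longrightarrow> T y"
      by (auto simp: eventually_at_right[OF bounds[of z]])
    then show ?thesis using TR by blast
  qed (use bounds in blast)
  then obtain b where "\<And>z. L z < b z"
    and "\<And>z p. z \<in> Y \<Longrightarrow> L z < ereal (p $ z) \<Longrightarrow> ereal (p $ z) < b z \<Longrightarrow> R z p"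
    by metis
  then show thesis using RP by (intro that[of b]) auto
qed

text \<open>Each coordinate in \<open>A\<close> has its own witness. As \<open>A\<close> is finite,
  directedness merges the witnesses into one, and moving up in \<open>S\<close> loses no threshold
  already passed.\<close>

lemma directed_exceeds_thresholds:
  fixes S :: "(real ^ 'z::finite) set"
  assumes "S \<noteq> {}"
    and dir: "\<And>p p'. p \<in> S \<Longrightarrow> p' \<in> S \<Longrightarrow> \<exists>r\<in>S. p \<le> r \<and> p' \<le> r"
    and ex: "\<And>z. z \<in> A \<Longrightarrow> \<exists>p\<in>S. b z < ereal (p $ z)"
  shows "\<exists>p\<in>S. \<forall>z\<in>A. b z < ereal (p $ z)"
proof -
  have "finite A" by simp
  then show ?thesis using ex
  proof (induction A)
    case empty
    then show ?case using \<open>S \<noteq> {}\<close> by auto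
  next
    case (insert a A)
    then obtain p p' where p: "p \<in> S" "\<forall>z\<in>A. b z < ereal (p $ z)"
      and p': "p' \<in> S" "b a < ereal (p' $ a)" by (metis insertCI)
    then obtain r where r: "r \<in> S" "p \<le> r" "p' \<le> r" using dir by blast
    have "b z < ereal (r $ z)" if "z \<in> insert a A" for z
    proof (cases "z = a")
      case True
      have "ereal (p' $ a) \<le> ereal (r $ a)" using r(3) by (simp add: less_eq_vec_def)
      then show ?thesis using True p'(2) by (metis order_less_le_trans)
    next
      case False
      have "ereal (p $ z) \<le> ereal (r $ z)" using r(2) by (simp add: less_eq_vec_def)
      then show ?thesis using False that p(2) by (metis insertE order_less_le_trans)
    qed
    then show ?case using r(1) by blast
  qed
qed

lemma open_box_neg: "p \<in> open_box (\<lambda>z. - U z) (\<lambda>z. - L z) \<longleftrightarrow> - p \<in> open_box L U"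
  unfolding open_box_def mem_Collect_eq
  by (metis (no_types, lifting) ereal_minus_less_minus ereal_uminus_uminus
      uminus_ereal.simps(1) vector_uminus_component)

lemma open_box_between:
  assumes "a \<in> open_box L U" "b \<in> open_box L U" "a \<le> p" "p \<le> b"
  shows "p \<in> open_box L U"
proof -
  have "ereal (a $ z) \<le> ereal (p $ z)" "ereal (p $ z) \<le> ereal (b $ z)" for z
    using assms(3,4) by (auto simp: less_eq_vec_def)
  then show ?thesis
    using assms(1,2) unfolding open_box_def mem_Collect_eq
    by (metis order_less_le_trans order_le_less_trans)
qed

lemma sum_add_sum_Compl:
  fixes f :: "'z::finite \<Rightarrow> real"
  shows "sum f X + sum f (- X) = sum f UNIV"
  using sum.subset_diff[of X UNIV f] by (simp add: Compl_eq_Diff_UNIV)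

section \<open>Order structure of the solution set\<close>

text \<open>The hypotheses collected here are stable under reversing all signs, as
  \<open>dual\<close> shows, so that a result about upper bounds transfers to lower bounds.\<close>

locale connected_substitutes =
  fixes L U :: "'z::finite \<Rightarrow> ereal"
    and Q :: "real ^ 'z \<Rightarrow> real ^ 'z"
    and q :: "real ^ 'z"
    and c :: real
  assumes bounds: "L z < U z"
    and Q_sum: "p \<in> open_box L U \<Longrightarrow> (\<Sum>z\<in>UNIV. Q p $ z) = c"
    and q_sum: "(\<Sum>z\<in>UNIV. q $ z) = c"
    and connected: "connected_strict_substitutes (open_box L U) Q"
begin

lemma sum_strict_antimono:
  assumes "p \<in> open_box L U" "p' \<in> open_box L U" "X \<noteq> {}"
    and "\<And>x. x \<in> X \<Longrightarrow> p $ x = p' $ x" "\<And>y. y \<notin> X \<Longrightarrow> p $ y \<le> p' $ y" "p \<noteq> p'"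
  shows "(\<Sum>x\<in>X. Q p' $ x) < (\<Sum>x\<in>X. Q p $ x)"
  using connected assms unfolding connected_strict_substitutes_def by blast

lemma sum_antimono:
  assumes "p \<in> open_box L U" "p' \<in> open_box L U"
    and "\<And>x. x \<in> X \<Longrightarrow> p $ x = p' $ x" "\<And>y. y \<notin> X \<Longrightarrow> p $ y \<le> p' $ y"
  shows "(\<Sum>x\<in>X. Q p' $ x) \<le> (\<Sum>x\<in>X. Q p $ x)"
  using sum_strict_antimono[OF assms(1,2) _ assms(3,4)]
  by (cases "X = {}"; cases "p = p'") (auto intro: less_imp_le)

text \<open>Raising coordinates in \<open>X\<close> cannot raise the sum over the complement, and
  the total is always \<open>c\<close>, so the sum over \<open>X\<close> takes up the
  difference.\<close>

lemma sum_mono_on: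
  assumes "p \<in> open_box L U" "p' \<in> open_box L U"
    and "\<And>x. x \<in> X \<Longrightarrow> p $ x \<le> p' $ x" "\<And>y. y \<notin> X \<Longrightarrow> p $ y = p' $ y"
  shows "(\<Sum>x\<in>X. Q p $ x) \<le> (\<Sum>x\<in>X. Q p' $ x)"
proof -
  have "(\<Sum>x\<in>-X. Q p' $ x) \<le> (\<Sum>x\<in>-X. Q p $ x)"
    using assms by (intro sum_antimono) auto
  then show ?thesis
    using sum_add_sum_Compl[of "\<lambda>x. Q p $ x" X]
      sum_add_sum_Compl[of "\<lambda>x. Q p' $ x" X] Q_sum assms(1,2) by simp
qed

lemma component_antimono:
  assumes "p \<in> open_box L U" "p' \<in> open_box L U" "p $ x = p' $ x" "p \<le> p'"
  shows "Q p' $ x \<le> Q p $ x"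
  using sum_antimono[of p p' "{x}"] assms by (auto simp: less_eq_vec_def)

definition solutions :: "(real ^ 'z) set" where
  "solutions = {p \<in> open_box L U. Q p = q}"

lemma solutions_ordered:
  assumes p: "p \<in> solutions" and p': "p' \<in> solutions" and w: "p $ w \<le> p' $ w" and "p \<noteq> p'"
  shows "p $ z < p' $ z"
proof -
  have E: "p \<in> open_box L U" "p' \<in> open_box L U" and Qp: "Q p = q" "Q p' = q"
    using p p' by (auto simp: solutions_def)
  \<comment> \<open>The minimum \<open>m\<close> agrees with \<open>p\<close> on \<open>A\<close>
    and with \<open>p'\<close> off \<open>A\<close>, so each half of its total can be compared with
    a solution. The set \<open>A\<close> contains \<open>w\<close>, hence is nonempty.\<close>
  define A where "A = {z. p $ z \<le> p' $ z}"
  define m :: "real ^ 'z" where "m = (\<chi> z. min (p $ z) (p' $ z))"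
  have mE: "m \<in> open_box L U"
    using E unfolding open_box_def m_def by (auto simp: min_def)
  have "A = UNIV"
  proof (rule ccontr)
    assume "A \<noteq> UNIV"
    then obtain y where "y \<notin> A" by auto
    then have "m $ y \<noteq> p $ y" by (auto simp: A_def m_def)
    then have "m \<noteq> p" by auto
    have "(\<Sum>x\<in>A. Q p $ x) < (\<Sum>x\<in>A. Q m $ x)"
      using mE E \<open>m \<noteq> p\<close> w by (intro sum_strict_antimono) (auto simp: A_def m_def)
    moreover have "(\<Sum>x\<in>-A. Q p' $ x) \<le> (\<Sum>x\<in>-A. Q m $ x)"
      using mE E by (intro sum_antimono) (auto simp: A_def m_def)
    ultimately show False
      using sum_add_sum_Compl[of "\<lambda>x. q $ x" A]
        sum_add_sum_Compl[of "\<lambda>x. Q m $ x" A] Q_sum[OF mE] q_sum Qp by simp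
  qed
  then have le: "p $ z \<le> p' $ z" for z by (auto simp: A_def)
  show ?thesis
  proof (rule ccontr)
    assume "\<not> p $ z < p' $ z"
    then have "p $ z = p' $ z" using le[of z] by simp
    \<comment> \<open>Connectedness is applied to the set where the two solutions coincide, which
      contains \<open>z\<close>. Both sums equal the sum of \<open>q\<close> over that set, so they
      cannot differ.\<close>
    then have "(\<Sum>x | p $ x = p' $ x. Q p' $ x) < (\<Sum>x | p $ x = p' $ x. Q p $ x)"
      using E le \<open>p \<noteq> p'\<close> by (intro sum_strict_antimono) auto
    then show False using Qp by simp
  qed
qed

lemma solutions_mono:
  assumes "p \<in> solutions" "p' \<in> solutions" "p $ w \<le> p' $ w"
  shows "p \<le> p'"
  using solutions_ordered[OF assms] by (cases "p = p'") (auto simp: less_eq_vec_def intro: less_imp_le)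

lemma solutions_inj:
  assumes "p \<in> solutions" "p' \<in> solutions" "p $ w = p' $ w"
  shows "p = p'"
  using solutions_ordered[OF assms(1,2), of w w] assms(3) by auto

lemma solutions_total:
  assumes "p \<in> solutions" "p' \<in> solutions"
  shows "p \<le> p' \<or> p' \<le> p"
proof -
  \<comment> \<open>Any coordinate serves here, since a single one decides the order of two
    solutions.\<close>
  fix w :: 'z
  show ?thesis
    using solutions_mono[OF assms, of w] solutions_mono[OF assms(2,1), of w] by linarith
qed

section \<open>Pivotality and approach to the upper boundary\<close>

text \<open>Downward pivotality without filters, so that it can be transported along
  \<open>p \<mapsto> - p\<close>.\<close>

definition upper_thresholds :: bool where
  "upper_thresholds \<longleftrightarrow>
     (\<forall>B. \<forall>p0\<in>open_box L U. B \<noteq> {} \<longrightarrow> B \<noteq> UNIV \<longrightarrow>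
        (\<exists>b. (\<forall>z. b z < U z) \<and>
           (\<forall>p\<in>open_box L U. (\<forall>x. x \<notin> B \<longrightarrow> p $ x = p0 $ x) \<and> (\<forall>z\<in>B. b z < ereal (p $ z))
              \<longrightarrow> (\<Sum>x\<in>-B. Q p $ x) < (\<Sum>x\<in>-B. q $ x))))"

lemma upper_thresholdsI:
  assumes "downward_pivotal_substitutes L U Q q"
  shows "upper_thresholds"
  unfolding upper_thresholds_def
proof (intro allI impI ballI)
  fix B :: "'z set" and p0
  assume "p0 \<in> open_box L U" "B \<noteq> {}" "B \<noteq> UNIV"
  \<comment> \<open>Pivotality is stated for the set of fixed coordinates, whereas \<open>B\<close>
    is the set of moving ones; it is therefore used with \<open>- B\<close>.\<close>
  moreover from this have "- B \<noteq> {}" "- B \<noteq> UNIV" by auto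
  ultimately have "\<forall>\<^sub>F p in coords_to_upper U B p0. (\<Sum>x\<in>-B. Q p $ x) < (\<Sum>x\<in>-B. q $ x)"
    using assms unfolding downward_pivotal_substitutes_def by (metis double_complement)
  from eventually_coords_to_upper_threshold[OF this bounds]
  obtain b where b: "\<And>z. b z < U z" and
    bP: "\<And>p. (\<And>x. x \<notin> B \<Longrightarrow> p $ x = p0 $ x) \<Longrightarrow>
              (\<And>z. z \<in> B \<Longrightarrow> b z < ereal (p $ z) \<and> ereal (p $ z) < U z) \<Longrightarrow>
              (\<Sum>x\<in>-B. Q p $ x) < (\<Sum>x\<in>-B. q $ x)" by blast
  show "\<exists>b. (\<forall>z. b z < U z) \<and>
           (\<forall>p\<in>open_box L U. (\<forall>x. x \<notin> B \<longrightarrow> p $ x = p0 $ x) \<and> (\<forall>z\<in>B. b z < ereal (p $ z))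
              \<longrightarrow> (\<Sum>x\<in>-B. Q p $ x) < (\<Sum>x\<in>-B. q $ x))"
  proof (intro exI[of _ b] conjI allI ballI impI)
    fix p assume "p \<in> open_box L U" "(\<forall>x. x \<notin> B \<longrightarrow> p $ x = p0 $ x) \<and> (\<forall>z\<in>B. b z < ereal (p $ z))"
    then show "(\<Sum>x\<in>-B. Q p $ x) < (\<Sum>x\<in>-B. q $ x)" by (intro bP) (auto simp: open_box_def)
  qed (rule b)
qed

text \<open>Pivotality forces the coordinates in which a directed set approaches the upper boundary
  to be none or all of them.\<close>

lemma upper_saturation:
  fixes S :: "(real ^ 'z) set"
  defines "B \<equiv> {z. \<forall>u<U z. \<exists>p\<in>S. u < ereal (p $ z)}"
  assumes "S \<noteq> {}" and SE: "S \<subseteq> open_box L U"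
    and dir: "\<And>p p'. p \<in> S \<Longrightarrow> p' \<in> S \<Longrightarrow> \<exists>r\<in>S. p \<le> r \<and> p' \<le> r"
    and piv: "upper_thresholds"
    and ge: "\<And>p. p \<in> S \<Longrightarrow> (\<Sum>x\<in>-B. q $ x) \<le> (\<Sum>x\<in>-B. Q p $ x)"
  shows "B = {} \<or> B = UNIV"
proof (rule ccontr)
  assume "\<not> ?thesis"
  then have B: "B \<noteq> {}" "B \<noteq> UNIV" by auto
  \<comment> \<open>Off \<open>B\<close> the set \<open>S\<close> stays below some
    \<open>u < U z\<close>. A real \<open>v\<close> above both \<open>u\<close> and
    \<open>L z\<close> bounds it and still lies in the box, so it can serve as the base point of
    pivotality.\<close>
  have "\<exists>v. L z < ereal v \<and> ereal v < U z \<and> (z \<notin> B \<longrightarrow> (\<forall>p\<in>S. p $ z \<le> v))" for z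
  proof (cases "z \<in> B")
    case True
    then show ?thesis using ereal_dense2[OF bounds[of z]] by auto
  next
    case False
    then obtain u where u: "u < U z" "\<And>p. p \<in> S \<Longrightarrow> ereal (p $ z) \<le> u"
      by (auto simp: B_def not_less)
    then have "max u (L z) < U z" using bounds by simp
    then obtain v where v: "max u (L z) < ereal v" "ereal v < U z" using ereal_dense2 by blast
    have "p $ z \<le> v" if "p \<in> S" for p
    proof -
      have "ereal (p $ z) \<le> u" using u(2) that .
      also have "u \<le> ereal v" using v(1) by (simp add: less_imp_le)
      finally show ?thesis by simp
    qed
    then show ?thesis using v by auto
  qed
  then obtain v where v: "\<And>z. L z < ereal (v z)" "\<And>z. ereal (v z) < U z"
    "\<And>z p. z \<notin> B \<Longrightarrow> p \<in> S \<Longrightarrow> p $ z \<le> v z" by metis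
  have "(\<chi> z. v z) \<in> open_box L U" using v by (simp add: open_box_def)
  with piv B obtain b where b: "\<And>z. b z < U z" and
    bQ: "\<And>p. p \<in> open_box L U \<Longrightarrow> (\<And>x. x \<notin> B \<Longrightarrow> p $ x = v x) \<Longrightarrow> (\<And>z. z \<in> B \<Longrightarrow> b z < ereal (p $ z))
              \<Longrightarrow> (\<Sum>x\<in>-B. Q p $ x) < (\<Sum>x\<in>-B. q $ x)"
    unfolding upper_thresholds_def by (metis (no_types, lifting) vec_lambda_beta)
  have "\<exists>p\<in>S. \<forall>z\<in>B. b z < ereal (p $ z)"
    using \<open>S \<noteq> {}\<close> dir b by (intro directed_exceeds_thresholds) (auto simp: B_def)
  then obtain p where p: "p \<in> S" "\<And>z. z \<in> B \<Longrightarrow> b z < ereal (p $ z)" by blast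
  have pE: "p \<in> open_box L U" using p SE by blast
  \<comment> \<open>Passing from \<open>p\<close> to \<open>r\<close> raises only coordinates off
    \<open>B\<close>, which cannot lower the sum over \<open>- B\<close>. Since \<open>r\<close> has
    the base values \<open>v\<close> there and passes the thresholds on \<open>B\<close>, that sum
    is nevertheless too small.\<close>
  define r :: "real ^ 'z" where "r = (\<chi> z. if z \<in> B then p $ z else v z)"
  have rE: "r \<in> open_box L U" using pE v by (auto simp: open_box_def r_def)
  have "(\<Sum>x\<in>-B. Q p $ x) \<le> (\<Sum>x\<in>-B. Q r $ x)"
    using pE rE v(3) p(1) by (intro sum_mono_on) (auto simp: r_def)
  also have "\<dots> < (\<Sum>x\<in>-B. q $ x)" using rE p(2) by (intro bQ) (auto simp: r_def)
  finally show False using ge[OF p(1)] by simp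
qed

section \<open>Sign reversal and solutions near the bounds\<close>

text \<open>Negating the argument reverses the order and negating the value reverses it again, so
  the strict decrease in connected strict substitutes survives.\<close>

lemma dual: "connected_substitutes (\<lambda>z. - U z) (\<lambda>z. - L z) (\<lambda>p. - Q (- p)) (- q) (- c)"
proof
  show "- U z < - L z" for z using bounds by simp
  show "(\<Sum>z\<in>UNIV. (- Q (- p)) $ z) = - c" if "p \<in> open_box (\<lambda>z. - U z) (\<lambda>z. - L z)" for p
    using Q_sum[of "- p"] that by (simp add: open_box_neg sum_negf)
  show "(\<Sum>z\<in>UNIV. (- q) $ z) = - c" using q_sum by (simp add: sum_negf)
  show "connected_strict_substitutes (open_box (\<lambda>z. - U z) (\<lambda>z. - L z)) (\<lambda>p. - Q (- p))"
    unfolding connected_strict_substitutes_def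
  proof (intro allI impI ballI, elim conjE)
    fix X :: "'z set" and p p' :: "real ^ 'z"
    assume "X \<noteq> {}" "p \<in> open_box (\<lambda>z. - U z) (\<lambda>z. - L z)" "p' \<in> open_box (\<lambda>z. - U z) (\<lambda>z. - L z)"
      "\<forall>x\<in>X. p $ x = p' $ x" "\<forall>y. y \<notin> X \<longrightarrow> p $ y \<le> p' $ y" "p \<noteq> p'"
    then have "(\<Sum>x\<in>X. Q (- p) $ x) < (\<Sum>x\<in>X. Q (- p') $ x)"
      by (intro sum_strict_antimono) (auto simp: open_box_neg)
    then show "(\<Sum>x\<in>X. (- Q (- p')) $ x) < (\<Sum>x\<in>X. (- Q (- p)) $ x)" by (simp add: sum_negf)
  qed
qed

text \<open>Solutions form a chain, and \<open>Q p = q\<close> gives the inequality needed for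
  \<open>upper_saturation\<close> with equality. The saturated set contains \<open>z0\<close>, so it
  is everything, and one solution passes all thresholds at once.\<close>

lemma solutions_above:
  assumes piv: "upper_thresholds"
    and z0: "\<And>u. u < U z0 \<Longrightarrow> \<exists>p\<in>solutions. u < ereal (p $ z0)"
    and b: "\<And>z. b z < U z"
  shows "\<exists>p\<in>solutions. \<forall>z. b z < ereal (p $ z)"
proof -
  have ne: "solutions \<noteq> {}" using z0 b by blast
  have dir: "\<exists>r\<in>solutions. p \<le> r \<and> p' \<le> r" if "p \<in> solutions" "p' \<in> solutions" for p p'
    using solutions_total that by blast
  have "{z. \<forall>u<U z. \<exists>p\<in>solutions. u < ereal (p $ z)} = UNIV"
    using upper_saturation[OF ne _ dir piv] z0 by (fastforce simp: solutions_def)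
  then have "\<exists>p\<in>solutions. \<forall>z\<in>UNIV. b z < ereal (p $ z)"
    using b by (intro directed_exceeds_thresholds[OF ne dir]) blast+
  then show ?thesis by simp
qed

text \<open>This is \<open>solutions_above\<close> for the sign-reversed system, whose thresholds at
  the upper bounds come from upward pivotality of \<open>Q\<close> at the lower bounds.\<close>

lemma solutions_below:
  assumes piv: "upward_pivotal_substitutes L U Q q"
    and z0: "\<And>u. L z0 < u \<Longrightarrow> \<exists>p\<in>solutions. ereal (p $ z0) < u"
    and b: "\<And>z. L z < b z"
  shows "\<exists>p\<in>solutions. \<forall>z. ereal (p $ z) < b z"
proof -
  interpret D: connected_substitutes "\<lambda>z. - U z" "\<lambda>z. - L z" "\<lambda>p. - Q (- p)" "- q" "- c"
    by (rule dual)
  have sol: "p \<in> D.solutions \<longleftrightarrow> - p \<in> solutions" for p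
    by (simp add: D.solutions_def solutions_def open_box_neg)
  have neg_less: "- u < ereal x \<longleftrightarrow> ereal (- x) < u" for u x
    by (metis ereal_minus_less_minus ereal_uminus_uminus uminus_ereal.simps(1))
  have "\<exists>p\<in>D.solutions. \<forall>z. - b z < ereal (p $ z)"
  proof (rule D.solutions_above[of z0])
    show "D.upper_thresholds"
      unfolding D.upper_thresholds_def
    proof (intro allI impI ballI)
      fix B :: "'z set" and p0
      assume p0: "p0 \<in> open_box (\<lambda>z. - U z) (\<lambda>z. - L z)" and B: "B \<noteq> {}" "B \<noteq> UNIV"
      from B have "- B \<noteq> {}" "- B \<noteq> UNIV" by auto
      then have "\<forall>\<^sub>F p in coords_to_lower L B (- p0). (\<Sum>x\<in>-B. q $ x) < (\<Sum>x\<in>-B. Q p $ x)"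
        using piv p0 unfolding upward_pivotal_substitutes_def open_box_neg
        by (metis double_complement)
      from eventually_coords_to_lower_threshold[OF this bounds]
      obtain d where d: "\<And>z. L z < d z" and
        dP: "\<And>p. (\<And>x. x \<notin> B \<Longrightarrow> p $ x = (- p0) $ x) \<Longrightarrow>
                  (\<And>z. z \<in> B \<Longrightarrow> L z < ereal (p $ z) \<and> ereal (p $ z) < d z) \<Longrightarrow>
                  (\<Sum>x\<in>-B. q $ x) < (\<Sum>x\<in>-B. Q p $ x)" by blast
      show "\<exists>b. (\<forall>z. b z < - L z) \<and>
           (\<forall>p\<in>open_box (\<lambda>z. - U z) (\<lambda>z. - L z).
              (\<forall>x. x \<notin> B \<longrightarrow> p $ x = p0 $ x) \<and> (\<forall>z\<in>B. b z < ereal (p $ z))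
              \<longrightarrow> (\<Sum>x\<in>-B. (- Q (- p)) $ x) < (\<Sum>x\<in>-B. (- q) $ x))"
      proof (intro exI[of _ "\<lambda>z. - d z"] conjI allI ballI impI)
        fix p assume "p \<in> open_box (\<lambda>z. - U z) (\<lambda>z. - L z)"
          "(\<forall>x. x \<notin> B \<longrightarrow> p $ x = p0 $ x) \<and> (\<forall>z\<in>B. - d z < ereal (p $ z))"
        then have "(\<Sum>x\<in>-B. q $ x) < (\<Sum>x\<in>-B. Q (- p) $ x)"
          by (intro dP) (auto simp: open_box_neg neg_less, auto simp: open_box_def)
        then show "(\<Sum>x\<in>-B. (- Q (- p)) $ x) < (\<Sum>x\<in>-B. (- q) $ x)" by (simp add: sum_negf)
      qed (use d in simp)
    qed
    show "\<exists>p\<in>D.solutions. u < ereal (p $ z0)" if "u < - L z0" for u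
    proof -
      have "L z0 < - u" using that by (simp add: ereal_less_uminus_reorder)
      from z0[OF this] obtain p where "p \<in> solutions" "ereal (p $ z0) < - u" by blast
      then show ?thesis
        by (intro bexI[of _ "- p"]) (auto simp: sol ereal_less_uminus_reorder)
    qed
    show "- b z < - L z" for z using b by simp
  qed
  then obtain p where "p \<in> D.solutions" "\<And>z. - b z < ereal (p $ z)" by blast
  then show ?thesis by (intro bexI[of _ "- p"]) (auto simp: sol neg_less)
qed

section \<open>Existence of a solution with prescribed coordinate \<open>z0\<close>\<close>

text \<open>Coordinates are lowered in the order of \<open>zs\<close>. Lowering
  \<open>zs ! k\<close> far enough brings \<open>Qbar k\<close> below its target, and the earlier
  bounds do not see that coordinate.\<close>

lemma subsolution_exists:
  assumes ord: "sequential_downward_bounds L U z0 Q q"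
    and \<pi>: "L z0 < ereal \<pi>" "ereal \<pi> < U z0"
  shows "\<exists>p\<in>open_box L U. p $ z0 = \<pi> \<and> (\<forall>y. y \<noteq> z0 \<longrightarrow> Q p $ y \<le> q $ y)"
proof -
  from ord obtain zs where zs: "distinct zs" "set zs = UNIV" "zs ! 0 = z0" and
    "\<forall>k. 1 \<le> k \<and> k < length zs \<longrightarrow> (\<exists>Qbar. (\<forall>p\<in>open_box L U. Q p $ (zs ! k) \<le> Qbar p) \<and>
       (\<forall>p\<in>open_box L U. \<forall>p'\<in>open_box L U.
          (\<forall>j\<le>k. p $ (zs ! j) = p' $ (zs ! j)) \<longrightarrow> Qbar p = Qbar p') \<and>
       downward_responsive L U Qbar (zs ! k) (q $ (zs ! k)))"
    unfolding sequential_downward_bounds_def by blast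
  then have "\<forall>k. \<exists>Qbar. 1 \<le> k \<and> k < length zs \<longrightarrow> (\<forall>p\<in>open_box L U. Q p $ (zs ! k) \<le> Qbar p) \<and>
       (\<forall>p\<in>open_box L U. \<forall>p'\<in>open_box L U.
          (\<forall>j\<le>k. p $ (zs ! j) = p' $ (zs ! j)) \<longrightarrow> Qbar p = Qbar p') \<and>
       downward_responsive L U Qbar (zs ! k) (q $ (zs ! k))"
    by blast
  from choice[OF this] obtain Qbar where
    Qbar: "\<forall>k. 1 \<le> k \<and> k < length zs \<longrightarrow> (\<forall>p\<in>open_box L U. Q p $ (zs ! k) \<le> Qbar k p) \<and>
       (\<forall>p\<in>open_box L U. \<forall>p'\<in>open_box L U.
          (\<forall>j\<le>k. p $ (zs ! j) = p' $ (zs ! j)) \<longrightarrow> Qbar k p = Qbar k p') \<and>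
       downward_responsive L U (Qbar k) (zs ! k) (q $ (zs ! k))"
    by blast
  have QQ: "Q p $ (zs ! k) \<le> Qbar k p" if "1 \<le> k" "k < length zs" "p \<in> open_box L U" for k p
    using Qbar that by blast
  have dep: "Qbar k p = Qbar k p'"
    if "1 \<le> k" "k < length zs" "p \<in> open_box L U" "p' \<in> open_box L U"
      "\<forall>j\<le>k. p $ (zs ! j) = p' $ (zs ! j)" for k p p'
    using Qbar that by blast
  have resp: "downward_responsive L U (Qbar k) (zs ! k) (q $ (zs ! k))"
    if "1 \<le> k" "k < length zs" for k
    using Qbar that by blast
  have len: "0 < length zs" using zs(2) by (cases zs) auto
  \<comment> \<open>The index \<open>j\<close> starts at 1 because \<open>zs ! 0\<close> is
    \<open>z0\<close>, which stays pinned at \<pi>.\<close>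
  have "\<exists>p\<in>open_box L U. p $ z0 = \<pi> \<and>
      (\<forall>j. 1 \<le> j \<and> j < k \<longrightarrow> Qbar j p < q $ (zs ! j))" if "k \<le> length zs" for k
    using that
  proof (induction k)
    case 0
    have "\<exists>v. L z < ereal v \<and> ereal v < U z" for z
      using ereal_dense2[OF bounds[of z]] by auto
    then obtain v where "\<And>z. L z < ereal (v z)" "\<And>z. ereal (v z) < U z" by metis
    then show ?case using \<pi>
      by (intro bexI[of _ "\<chi> z. if z = z0 then \<pi> else v z"]) (auto simp: open_box_def)
  next
    case (Suc k)
    then obtain p where p: "p \<in> open_box L U" "p $ z0 = \<pi>"
      "\<And>j. 1 \<le> j \<Longrightarrow> j < k \<Longrightarrow> Qbar j p < q $ (zs ! j)" by auto
    show ?case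
    proof (cases "k = 0")
      case True
      then show ?thesis using p by auto
    next
      case False
      then have k: "1 \<le> k" "k < length zs" using Suc.prems by auto
      from resp[OF k] p(1) obtain l where
        "((\<lambda>p. ereal (Qbar k p)) \<longlongrightarrow> l) (coords_to_lower L {zs ! k} p)" "l < ereal (q $ (zs ! k))"
        unfolding downward_responsive_def by blast
      then have "\<forall>\<^sub>F p in coords_to_lower L {zs ! k} p. Qbar k p < q $ (zs ! k)"
        by (auto dest: order_tendstoD(2))
      from eventually_coords_to_lower_threshold[OF this bounds]
      obtain b where b: "\<And>z. L z < b z" and
        bP: "\<And>r. (\<And>x. x \<notin> {zs ! k} \<Longrightarrow> r $ x = p $ x) \<Longrightarrow>
                  (\<And>z. z \<in> {zs ! k} \<Longrightarrow> L z < ereal (r $ z) \<and> ereal (r $ z) < b z) \<Longrightarrow>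
                  Qbar k r < q $ (zs ! k)" by blast
      \<comment> \<open>The new value must lie below the threshold and, to remain in the box, below
        the upper bound.\<close>
      have "L (zs ! k) < min (b (zs ! k)) (U (zs ! k))" using b bounds by simp
      then obtain v where v: "L (zs ! k) < ereal v" "ereal v < b (zs ! k)" "ereal v < U (zs ! k)"
        using ereal_dense2 by (metis min_less_iff_conj)
      define r where "r = (\<chi> z. if z = zs ! k then v else p $ z)"
      have rE: "r \<in> open_box L U" using p(1) v by (auto simp: open_box_def r_def)
      have ne: "zs ! j \<noteq> zs ! k" if "j < k" for j
        using that k zs(1) by (simp add: nth_eq_iff_index_eq)
      have "Qbar k r < q $ (zs ! k)" using v by (intro bP) (auto simp: r_def)
      moreover have "Qbar j r = Qbar j p" if "1 \<le> j" "j < k" for j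
      proof (rule dep)
        show "\<forall>i\<le>j. r $ (zs ! i) = p $ (zs ! i)"
        proof (intro allI impI)
          fix i assume "i \<le> j"
          then have "zs ! i \<noteq> zs ! k" using ne that(2) by simp
          then show "r $ (zs ! i) = p $ (zs ! i)" by (simp add: r_def)
        qed
      qed (use that k rE p(1) in auto)
      moreover have "r $ z0 = \<pi>" using ne[of 0] False zs(3) p(2) by (simp add: r_def)
      ultimately show ?thesis using p(3) rE by (intro bexI[of _ r]) (auto simp: less_Suc_eq)
    qed
  qed
  from this[of "length zs"] obtain p where p: "p \<in> open_box L U" "p $ z0 = \<pi>"
    "\<And>j. 1 \<le> j \<Longrightarrow> j < length zs \<Longrightarrow> Qbar j p < q $ (zs ! j)" by auto
  have "Q p $ y \<le> q $ y" if "y \<noteq> z0" for y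
  proof -
    obtain j where j: "j < length zs" "zs ! j = y" using zs(2) by (metis UNIV_I in_set_conv_nth)
    then have "1 \<le> j" using that zs(3) by (cases j) auto
    then show ?thesis using QQ[of j p] p(1) p(3)[of j] j by fastforce
  qed
  then show ?thesis using p by blast
qed

lemma solution_exists:
  assumes cont: "continuous_on (open_box L U) Q"
    and piv: "upper_thresholds"
    and ord: "sequential_downward_bounds L U z0 Q q"
    and \<pi>: "L z0 < ereal \<pi>" "ereal \<pi> < U z0"
  shows "\<exists>p\<in>solutions. p $ z0 = \<pi>"
proof -
  define S where "S = {p \<in> open_box L U. p $ z0 = \<pi> \<and> (\<forall>y. y \<noteq> z0 \<longrightarrow> Q p $ y \<le> q $ y)}"
  obtain s where s: "s \<in> S" using subsolution_exists[OF ord \<pi>] by (auto simp: S_def)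
  have SE: "S \<subseteq> open_box L U" by (auto simp: S_def)
  \<comment> \<open>The coordinatewise maximum works: at each \<open>y\<close> it agrees with
    \<open>p\<close> or \<open>p'\<close>, and raising the other coordinates does not raise the
    component of \<open>Q\<close> at \<open>y\<close>.\<close>
  have dir: "\<exists>r\<in>S. p \<le> r \<and> p' \<le> r" if "p \<in> S" "p' \<in> S" for p p'
  proof -
    define r :: "real ^ 'z" where "r = (\<chi> z. max (p $ z) (p' $ z))"
    have r: "p \<le> r" "p' \<le> r" by (auto simp: r_def less_eq_vec_def)
    have rE: "r \<in> open_box L U" using that unfolding S_def open_box_def r_def by (auto simp: max_def)
    have "Q r $ y \<le> q $ y" if "y \<noteq> z0" for y
    proof -
      have "r $ y = p $ y \<or> r $ y = p' $ y" by (auto simp: r_def max_def)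
      then show ?thesis
        using component_antimono[of p r y] component_antimono[of p' r y] rE r \<open>p \<in> S\<close> \<open>p' \<in> S\<close> that
        unfolding S_def by fastforce
    qed
    then have "r \<in> S" using rE that by (auto simp: S_def r_def)
    then show ?thesis using r by blast
  qed
  define B where "B = {z. \<forall>u<U z. \<exists>p\<in>S. u < ereal (p $ z)}"
  have z0B: "z0 \<notin> B" using \<pi>(2) by (auto simp: B_def S_def)
  have "B = {} \<or> B = UNIV" unfolding B_def
  proof (rule upper_saturation[OF _ SE dir piv])
    fix p assume "p \<in> S"
    then have pE: "p \<in> open_box L U" and le: "\<And>y. y \<noteq> z0 \<Longrightarrow> Q p $ y \<le> q $ y"
      by (auto simp: S_def)
    \<comment> \<open>Since \<open>z0\<close> is not in \<open>B\<close>, the sum over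
      \<open>B\<close> is at most its target; the common total \<open>c\<close> turns this into the
      lower bound over \<open>- B\<close> that saturation requires.\<close>
    have "(\<Sum>x\<in>B. Q p $ x) \<le> (\<Sum>x\<in>B. q $ x)" using z0B le by (intro sum_mono) metis
    then have "(\<Sum>x\<in>-B. q $ x) \<le> (\<Sum>x\<in>-B. Q p $ x)"
      using sum_add_sum_Compl[of "\<lambda>x. q $ x" B]
        sum_add_sum_Compl[of "\<lambda>x. Q p $ x" B] Q_sum[OF pE] q_sum by simp
    then show "(\<Sum>x\<in>- {z. \<forall>u<U z. \<exists>p\<in>S. u < ereal (p $ z)}. q $ x)
        \<le> (\<Sum>x\<in>- {z. \<forall>u<U z. \<exists>p\<in>S. u < ereal (p $ z)}. Q p $ x)"
      by (simp add: B_def)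
  qed (use s in auto)
  then have "B = {}" using z0B by auto
  \<comment> \<open>Real bounds strictly inside the box make the suprema finite and keep
    \<open>P\<close> off the upper boundary.\<close>
  have "\<exists>v. ereal v < U z \<and> (\<forall>p\<in>S. p $ z \<le> v)" for z
  proof -
    have "z \<notin> B" using \<open>B = {}\<close> by simp
    then obtain u where u: "u < U z" "\<And>p. p \<in> S \<Longrightarrow> ereal (p $ z) \<le> u"
      by (auto simp: B_def not_less)
    obtain v where v: "u < ereal v" "ereal v < U z" using ereal_dense2[OF u(1)] by blast
    have "p $ z \<le> v" if "p \<in> S" for p
    proof -
      have "ereal (p $ z) \<le> u" using u(2) that .
      also have "u \<le> ereal v" using v(1) by (rule less_imp_le)
      finally show ?thesis by simp
    qed
    then show ?thesis using v by auto
  qed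
  then obtain v where v: "\<And>z. ereal (v z) < U z" "\<And>z p. p \<in> S \<Longrightarrow> p $ z \<le> v z" by metis
  define P :: "real ^ 'z" where "P = (\<chi> z. SUP p\<in>S. p $ z)"
  have bdd: "bdd_above ((\<lambda>p. p $ z) ` S)" for z using v(2) by (auto intro!: bdd_aboveI2)
  have ub: "p \<le> P" if "p \<in> S" for p
    using that bdd by (auto simp: less_eq_vec_def P_def intro!: cSUP_upper)
  have "P \<le> (\<chi> z. v z)"
    using s v(2) by (auto simp: less_eq_vec_def P_def intro!: cSUP_least)
  have PE: "P \<in> open_box L U"
  proof (rule open_box_between)
    show "s \<in> open_box L U" using s SE by auto
    show "s \<le> P" using ub s .
    show "P \<le> (\<chi> z. v z)" by fact
    have "L z < ereal (v z)" for z
    proof -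
      have "L z < ereal (s $ z)" using s by (auto simp: S_def open_box_def)
      also have "\<dots> \<le> ereal (v z)" using v(2)[OF s] by simp
      finally show ?thesis .
    qed
    then show "(\<chi> z. v z) \<in> open_box L U" using v(1) by (simp add: open_box_def)
  qed
  \<comment> \<open>Directedness gives one element of \<open>S\<close> close to \<open>P\<close> in
    all coordinates simultaneously. The resulting sequence converges to \<open>P\<close>, which thus
    inherits the constraints defining \<open>S\<close> by continuity.\<close>
  have "\<exists>p\<in>S. \<forall>z\<in>UNIV. ereal (P $ z - 1 / real (Suc n)) < ereal (p $ z)" for n
  proof (rule directed_exceeds_thresholds[OF _ dir])
    fix z
    have "P $ z - 1 / real (Suc n) < (SUP p\<in>S. p $ z)" by (simp add: P_def)
    then show "\<exists>p\<in>S. ereal (P $ z - 1 / real (Suc n)) < ereal (p $ z)"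
      using s bdd by (subst (asm) less_cSUP_iff) auto
  qed (use s in auto)
  then obtain X where X: "\<And>n. X n \<in> S" "\<And>n z. P $ z - 1 / real (Suc n) < X n $ z"
    by (simp del: of_nat_Suc) metis
  have lim: "X \<longlonglongrightarrow> P"
  proof (rule vec_tendstoI)
    fix z
    have "(\<lambda>n. P $ z - 1 / real (Suc n)) \<longlonglongrightarrow> P $ z - 0"
      by (intro tendsto_intros LIMSEQ_Suc[OF lim_1_over_n])
    then have lower: "(\<lambda>n. P $ z - 1 / real (Suc n)) \<longlonglongrightarrow> P $ z" by simp
    have "P $ z - 1 / real (Suc n) \<le> X n $ z" for n using X(2) by (rule less_imp_le)
    moreover have "X n $ z \<le> P $ z" for n using ub[OF X(1)] unfolding less_eq_vec_def by blast
    ultimately show "(\<lambda>n. X n $ z) \<longlonglongrightarrow> P $ z"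
      by (intro tendsto_sandwich[OF _ _ lower tendsto_const] always_eventually allI)
  qed
  have "\<forall>\<^sub>F n in sequentially. X n \<in> open_box L U" using X(1) SE by (intro always_eventually) blast
  then have QX: "(\<lambda>n. Q (X n)) \<longlonglongrightarrow> Q P" by (rule continuous_on_tendsto_compose[OF cont lim PE])
  have "X n $ z0 = \<pi>" for n using X(1)[of n] by (simp add: S_def)
  then have "P $ z0 = \<pi>" using tendsto_vec_nth[OF lim, of z0] by (simp add: LIMSEQ_const_iff)
  moreover have "Q P $ y \<le> q $ y" if "y \<noteq> z0" for y
  proof (rule LIMSEQ_le_const2[OF tendsto_vec_nth[OF QX]])
    show "\<exists>N. \<forall>n\<ge>N. Q (X n) $ y \<le> q $ y" using X(1) that unfolding S_def by blast
  qed
  \<comment> \<open>If the inequality at \<open>y\<close> were strict, a small increase of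
    coordinate \<open>y\<close> alone would keep it by continuity and raise no other component with
    index other than \<open>z0\<close>. The raised point would lie in \<open>S\<close> above its
    supremum.\<close>
  moreover have "q $ y \<le> Q P $ y" if y: "y \<noteq> z0" for y
  proof (rule ccontr)
    assume "\<not> q $ y \<le> Q P $ y"
    define R where "R n = P + (1 / real (Suc n)) *\<^sub>R axis y 1" for n
    have R_nth: "R n $ z = (if z = y then P $ z + 1 / real (Suc n) else P $ z)" for n z
      by (simp add: R_def axis_def)
    have "(\<lambda>n. P + (1 / real (Suc n)) *\<^sub>R axis y 1) \<longlonglongrightarrow> P + 0 *\<^sub>R axis y 1"
      by (intro tendsto_intros LIMSEQ_Suc[OF lim_1_over_n])
    then have Rlim: "R \<longlonglongrightarrow> P" unfolding R_def by simp
    have "(\<lambda>n. ereal (P $ y + 1 / real (Suc n))) \<longlonglongrightarrow> ereal (P $ y + 0)"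
      by (intro tendsto_intros tendsto_ereal LIMSEQ_Suc[OF lim_1_over_n])
    then have evU: "\<forall>\<^sub>F n in sequentially. ereal (P $ y + 1 / real (Suc n)) < U y"
      by (rule order_tendstoD(2)) (use PE in \<open>auto simp: open_box_def\<close>)
    have RE_if: "R n \<in> open_box L U" if "ereal (P $ y + 1 / real (Suc n)) < U y" for n
    proof -
      have "L y < ereal (P $ y)" using PE by (simp add: open_box_def)
      also have "\<dots> \<le> ereal (P $ y + 1 / real (Suc n))" by simp
      finally show ?thesis using PE that by (auto simp: open_box_def R_nth)
    qed
    have evE: "\<forall>\<^sub>F n in sequentially. R n \<in> open_box L U"
      using evU by eventually_elim (rule RE_if)
    have "(\<lambda>n. Q (R n) $ y) \<longlonglongrightarrow> Q P $ y"
      by (intro tendsto_vec_nth continuous_on_tendsto_compose[OF cont Rlim PE evE])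
    then have "\<forall>\<^sub>F n in sequentially. Q (R n) $ y < q $ y"
      by (rule order_tendstoD(2)) (use \<open>\<not> q $ y \<le> Q P $ y\<close> in simp)
    then have "\<forall>\<^sub>F n in sequentially. R n \<in> open_box L U \<and> Q (R n) $ y < q $ y"
      using evE by eventually_elim auto
    then obtain n where n: "R n \<in> open_box L U" "Q (R n) $ y < q $ y"
      using eventually_happens'[OF sequentially_bot] by blast
    have "P \<le> R n" by (auto simp: less_eq_vec_def R_nth)
    have "Q (R n) $ x \<le> q $ x" if "x \<noteq> z0" for x
    proof (cases "x = y")
      case False
      then have "Q (R n) $ x \<le> Q P $ x"
        using \<open>P \<le> R n\<close> by (intro component_antimono PE n(1)) (auto simp: R_nth)
      then show ?thesis using \<open>\<And>y. y \<noteq> z0 \<Longrightarrow> Q P $ y \<le> q $ y\<close>[OF that] by linarith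
    qed (use n in simp)
    then have "R n \<in> S" using n(1) y \<open>P $ z0 = \<pi>\<close> by (auto simp: S_def R_nth)
    from ub[OF this] have "R n $ y \<le> P $ y" by (simp add: less_eq_vec_def)
    then show False by (simp add: R_nth)
  qed
  ultimately have eq: "Q P $ y = q $ y" if "y \<noteq> z0" for y using that by (simp add: antisym)
  \<comment> \<open>The one remaining equation, at \<open>z0\<close>, follows from the common total
    \<open>c\<close>.\<close>
  have "(\<Sum>x\<in>-{z0}. Q P $ x) = (\<Sum>x\<in>-{z0}. q $ x)" using eq by (intro sum.cong) auto
  then have "Q P $ z0 = q $ z0"
    using sum_add_sum_Compl[of "\<lambda>x. q $ x" "{z0}"]
      sum_add_sum_Compl[of "\<lambda>x. Q P $ x" "{z0}"] Q_sum[OF PE] q_sum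
    by simp
  then have "Q P = q" using eq by (metis vec_eq_iff)
  then show ?thesis using PE \<open>P $ z0 = \<pi>\<close> by (auto simp: solutions_def)
qed

section \<open>Continuity of the path of solutions\<close>

text \<open>On the solutions between \<open>f a\<close> and \<open>f b\<close> the projection to
  coordinate \<open>z0\<close> is continuous and has \<open>f\<close> as its inverse. These
  solutions form a compact set, so the inverse is continuous.\<close>

lemma continuous_on_solution_path:
  assumes cont: "continuous_on (open_box L U) Q"
    and f: "\<And>x. x \<in> {a..b} \<Longrightarrow> f x \<in> solutions" "\<And>x. x \<in> {a..b} \<Longrightarrow> f x $ z0 = x"
  shows "continuous_on {a..b} f"
proof (cases "a \<le> b")
  case True
  define C where "C = {p \<in> {f a..f b}. Q p = q}"
  have ab: "f a \<in> solutions" "f b \<in> solutions" using f(1) True by auto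
  have sub: "{f a..f b} \<subseteq> open_box L U"
    using ab open_box_between[of "f a" L U "f b"] by (auto simp: solutions_def)
  have C_sol: "C \<subseteq> solutions" using sub by (auto simp: C_def solutions_def)
  \<comment> \<open>The closed order interval lies inside the open box, so \<open>Q\<close> is
    continuous on it and its level set there is closed.\<close>
  have "closed C" unfolding C_def
    using continuous_on_subset[OF cont sub] closed_cbox[of "f a" "f b"]
    by (intro continuous_closed_preimage_constant) (auto simp: interval_cbox)
  moreover have "bounded C"
    by (rule bounded_subset[of "cbox (f a) (f b)"]) (auto simp: C_def interval_cbox)
  ultimately have "compact C" by (simp add: compact_eq_bounded_closed)
  have in_C: "f x \<in> C" if x: "x \<in> {a..b}" for x
  proof -
    have "f a \<le> f x" "f x \<le> f b"
      using f(2) x True by (auto intro!: solutions_mono[of _ _ z0] f(1))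
    then show ?thesis using f(1)[OF x] by (auto simp: C_def solutions_def)
  qed
  have inv: "f (p $ z0) = p" if p: "p \<in> C" for p
  proof -
    have "f a $ z0 \<le> p $ z0" "p $ z0 \<le> f b $ z0" using p by (auto simp: C_def less_eq_vec_def)
    then have "p $ z0 \<in> {a..b}" using f(2) True by auto
    then show ?thesis using f p C_sol by (intro solutions_inj[of _ _ z0]) auto
  qed
  have "continuous_on ((\<lambda>p. p $ z0) ` C) f"
    using inv by (intro continuous_on_inv \<open>compact C\<close>) (auto intro!: continuous_intros)
  then show ?thesis
    by (rule continuous_on_subset) (use in_C f(2) in force)
qed auto

end

section \<open>Runs of the bisection and their convergence\<close>

lemma dichotomy_run_exists:
  assumes "L0 < ereal a" "ereal a < U0" "\<psi> (ps a) \<le> K"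
    and "L0 < ereal b" "ereal b < U0" "K \<le> \<psi> (ps b)"
  shows "\<exists>lo hi mid. dichotomy_run L0 U0 ps \<psi> K lo hi mid"
proof -
  \<comment> \<open>When the target is hit exactly, this run updates the lower end.\<close>
  define step where "step I = (let m = (snd I + fst I) / 2
      in if \<psi> (ps m) \<le> K then (m, snd I) else (fst I, m))" for I :: "real \<times> real"
  define I where "I t = (step ^^ t) (a, b)" for t
  define mid where "mid t = (case t of 0 \<Rightarrow> b | Suc t \<Rightarrow> (snd (I t) + fst (I t)) / 2)" for t
  have "dichotomy_run L0 U0 ps \<psi> K (fst \<circ> I) (snd \<circ> I) mid"
    unfolding dichotomy_run_def using assms by (auto simp: I_def mid_def step_def Let_def)
  then show ?thesis by blast
qed

text \<open>Strict monotonicity turns a comparison of values with \<open>K\<close> into a comparison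
  of arguments with \<pi>. Hence every permitted update, including either one at a tie, keeps \<pi>
  in a bracket whose width halves.\<close>

lemma dichotomy_run_converges:
  assumes run: "dichotomy_run L0 U0 ps \<psi> K lo hi mid"
    and mono: "\<And>x y. L0 < ereal x \<Longrightarrow> ereal y < U0 \<Longrightarrow> x < y \<Longrightarrow> \<psi> (ps x) < \<psi> (ps y)"
    and cont: "\<And>a b. L0 < ereal a \<Longrightarrow> ereal b < U0 \<Longrightarrow> continuous_on {a..b} ps"
    and \<pi>: "L0 < ereal \<pi>" "ereal \<pi> < U0" "\<psi> (ps \<pi>) = K"
  shows "(\<lambda>t. ps (mid t)) \<longlonglongrightarrow> ps \<pi>"
proof -
  have start: "L0 < ereal (lo 0)" "ereal (lo 0) < U0" "\<psi> (ps (lo 0)) \<le> K"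
    "L0 < ereal (hi 0)" "ereal (hi 0) < U0" "K \<le> \<psi> (ps (hi 0))" "mid 0 = hi 0"
    and mid: "\<And>t. mid (Suc t) = (hi t + lo t) / 2"
    and upd: "\<And>t. \<psi> (ps (mid (Suc t))) \<le> K \<and> lo (Suc t) = mid (Suc t) \<and> hi (Suc t) = hi t \<or>
         \<psi> (ps (mid (Suc t))) \<ge> K \<and> lo (Suc t) = lo t \<and> hi (Suc t) = mid (Suc t)"
    using run unfolding dichotomy_run_def by auto
  have below: "x \<le> \<pi>" if "ereal x < U0" "\<psi> (ps x) \<le> K" for x
    using mono[of \<pi> x] \<pi> that by (cases "x \<le> \<pi>") auto
  have above: "\<pi> \<le> x" if "L0 < ereal x" "K \<le> \<psi> (ps x)" for x
    using mono[of x \<pi>] \<pi> that by (cases "\<pi> \<le> x") auto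
  have inside: "L0 < ereal x \<and> ereal x < U0" if "lo 0 \<le> x" "x \<le> hi 0" for x
  proof -
    have "ereal (lo 0) \<le> ereal x" "ereal x \<le> ereal (hi 0)" using that by auto
    then show ?thesis using start(1,5) by (metis order_less_le_trans order_le_less_trans)
  qed
  have bracket: "lo 0 \<le> lo t \<and> lo t \<le> \<pi> \<and> \<pi> \<le> hi t \<and> hi t \<le> hi 0 \<and>
      hi t - lo t = (hi 0 - lo 0) * (1 / 2) ^ t" for t
  proof (induction t)
    case 0
    then show ?case using below above start by auto
  next
    case (Suc t)
    have m: "lo t \<le> mid (Suc t)" "mid (Suc t) \<le> hi t" using Suc mid[of t] by auto
    then have "L0 < ereal (mid (Suc t)) \<and> ereal (mid (Suc t)) < U0" using Suc by (intro inside) auto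
    moreover have "hi (Suc t) - lo (Suc t) = (hi t - lo t) / 2"
      using upd[of t] mid[of t] by (auto simp: field_simps)
    then have "hi (Suc t) - lo (Suc t) = (hi 0 - lo 0) * (1 / 2) ^ Suc t" using Suc by simp
    ultimately show ?case
      using upd[of t] below[of "mid (Suc t)"] above[of "mid (Suc t)"] Suc m by auto
  qed
  \<comment> \<open>The tried points stay in the initial closed bracket, on which \<open>ps\<close>
    is continuous.\<close>
  have mid_in: "mid t \<in> {lo 0..hi 0}" for t
  proof (cases t)
    case 0
    then show ?thesis using bracket[of 0] start(7) by auto
  next
    case (Suc s)
    then show ?thesis using bracket[of s] mid[of s] by auto
  qed
  have "(\<lambda>t. (hi 0 - lo 0) * (1 / 2) ^ t) \<longlonglongrightarrow> (hi 0 - lo 0) * 0"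
    by (intro tendsto_intros LIMSEQ_realpow_zero) auto
  then have "(\<lambda>t. (hi 0 - lo 0) * (1 / 2) ^ t) \<longlonglongrightarrow> 0" by simp
  then have "(\<lambda>t. mid (Suc t) - \<pi>) \<longlonglongrightarrow> 0"
  proof (rule Lim_null_comparison[rotated], intro always_eventually allI)
    fix t
    show "norm (mid (Suc t) - \<pi>) \<le> (hi 0 - lo 0) * (1 / 2) ^ t"
    proof -
      have "lo t \<le> \<pi>" "\<pi> \<le> hi t" and width: "hi t - lo t = (hi 0 - lo 0) * (1 / 2) ^ t"
        using bracket[of t] by auto
      then have "mid (Suc t) - \<pi> \<le> hi t - lo t" "\<pi> - mid (Suc t) \<le> hi t - lo t"
        unfolding mid by (auto simp: field_simps)
      then show ?thesis unfolding width[symmetric] real_norm_def by (simp add: abs_le_iff)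
    qed
  qed
  then have "(\<lambda>t. mid (Suc t)) \<longlonglongrightarrow> \<pi>" by (rule LIM_zero_cancel)
  \<comment> \<open>The estimate concerns midpoints, hence indices from 1 on; \<open>mid 0\<close>
    is the initial upper end.\<close>
  then have "mid \<longlonglongrightarrow> \<pi>" by (rule LIMSEQ_imp_Suc)
  then show ?thesis
    using bracket[of 0] mid_in
    by (intro continuous_on_tendsto_compose[OF cont[OF start(1,5)]] always_eventually) auto
qed

section \<open>Crossing of the level \<open>K\<close> along the solution path\<close>

theorem theorem3:
  fixes L U :: "'z::finite \<Rightarrow> ereal"
    and z0 :: 'z
    and c :: real
    and q :: "real ^ 'z"
    and Q :: "real ^ 'z \<Rightarrow> real ^ 'z"
    and \<psi> :: "real ^ 'z \<Rightarrow> real"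
    and L\<psi> U\<psi> :: ereal
    and K :: real
  assumes bounds: "\<And>z. L z < U z"
    and q_in: "q \<in> hyperplane c"
    and Q_maps: "Q \<in> open_box L U \<rightarrow> hyperplane c"
    and Q_cont: "continuous_on (open_box L U) Q"
    and weak: "weak_substitutes (open_box L U) Q"
    and pivotal: "pivotal_substitutes L U Q q"
    and responsive: "\<And>x. upward_responsive L U (\<lambda>p. Q p $ x) x (q $ x) \<and>
                         downward_responsive L U (\<lambda>p. Q p $ x) x (q $ x)"
    and ordering: "sequential_downward_bounds L U z0 Q q"
    and connected: "connected_strict_substitutes (open_box L U) Q"
    and normalization: "normalization_mapping L U \<psi> L\<psi> U\<psi>"
    and strict: "\<And>p p'. (\<And>z. p $ z < p' $ z) \<Longrightarrow> \<psi> p < \<psi> p'"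
    and K_in: "L\<psi> < ereal K" "ereal K < U\<psi>"
  shows "(\<forall>\<pi>. L z0 < ereal \<pi> \<and> ereal \<pi> < U z0 \<longrightarrow>
             (\<exists>!p. is_pinned_solution (open_box L U) z0 Q q \<pi> p)) \<and>
         (\<exists>lo hi mid. dichotomy_run (L z0) (U z0) (pinned_solution (open_box L U) z0 Q q) \<psi> K lo hi mid) \<and>
         (\<exists>!p. p \<in> open_box L U \<and> Q p = q \<and> \<psi> p = K) \<and>
         (\<forall>p lo hi mid. p \<in> open_box L U \<and> Q p = q \<and> \<psi> p = K \<and>
             dichotomy_run (L z0) (U z0) (pinned_solution (open_box L U) z0 Q q) \<psi> K lo hi mid \<longrightarrow>
             (\<lambda>t. pinned_solution (open_box L U) z0 Q q (mid t)) \<longlonglongrightarrow> p)"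
proof -
  let ?E = "open_box L U"
  interpret connected_substitutes L U Q q c
    using bounds Q_maps q_in connected
    by unfold_locales (auto simp: hyperplane_def Pi_iff)
  \<comment> \<open>The names refer to the bound approached: downward pivotality acts at the upper
    bounds, upward pivotality at the lower bounds.\<close>
  have up: upper_thresholds and down: "upward_pivotal_substitutes L U Q q"
    using pivotal by (auto simp: pivotal_substitutes_def upper_thresholdsI)
  define ps where "ps = pinned_solution ?E z0 Q q"
  have ex: "\<exists>p\<in>solutions. p $ z0 = \<pi>" if "L z0 < ereal \<pi>" "ereal \<pi> < U z0" for \<pi>
    using solution_exists[OF Q_cont up ordering that] .
  have pinned_iff: "is_pinned_solution ?E z0 Q q \<pi> p \<longleftrightarrow> p \<in> solutions \<and> p $ z0 = \<pi>" for \<pi> p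
    by (auto simp: is_pinned_solution_def solutions_def)
  have ex1: "\<exists>!p. is_pinned_solution ?E z0 Q q \<pi> p" if "L z0 < ereal \<pi>" "ereal \<pi> < U z0" for \<pi>
    using ex[OF that] solutions_inj[of _ _ z0] unfolding pinned_iff by metis
  have ps: "ps \<pi> \<in> solutions" "ps \<pi> $ z0 = \<pi>" if "L z0 < ereal \<pi>" "ereal \<pi> < U z0" for \<pi>
    using theI'[OF ex1[OF that]] unfolding ps_def pinned_solution_def pinned_iff by auto
  have in_range: "L z0 < ereal (p $ z0)" "ereal (p $ z0) < U z0" if "p \<in> solutions" for p
    using that by (auto simp: solutions_def open_box_def)
  \<comment> \<open>Every solution lies on the path \<open>ps\<close>, so statements about solutions
    reduce to one real parameter.\<close>
  have ps_nth: "ps (p $ z0) = p" if "p \<in> solutions" for p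
    using ps[OF in_range[OF that]] that solutions_inj by blast
  have \<psi>_mono: "\<psi> p < \<psi> p'" if "p \<in> solutions" "p' \<in> solutions" "p $ z0 < p' $ z0" for p p'
    using that by (intro strict solutions_ordered[of p p' z0]) auto
  have between: "L z0 < ereal x \<and> ereal x < U z0"
    if "L z0 < ereal a" "ereal b < U z0" "a \<le> x" "x \<le> b" for a b x
    using that by (metis ereal_less_eq(3) order_le_less_trans order_less_le_trans)
  have ps_cont: "continuous_on {a..b} ps" if "L z0 < ereal a" "ereal b < U z0" for a b
    using between[OF that] ps by (intro continuous_on_solution_path[OF Q_cont, of _ _ _ z0]) auto
  have \<psi>_ps_mono: "\<psi> (ps x) < \<psi> (ps y)" if "L z0 < ereal x" "ereal y < U z0" "x < y" for x y
    using between[OF that(1,2), of x] between[OF that(1,2), of y] that ps by (intro \<psi>_mono) auto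
  have \<psi>: "continuous_on UNIV \<psi>"
    "((\<lambda>p. ereal (\<psi> p)) \<longlongrightarrow> L\<psi>) (coords_to_lower L UNIV 0)"
    "((\<lambda>p. ereal (\<psi> p)) \<longlongrightarrow> U\<psi>) (coords_to_upper U UNIV 0)"
    using normalization by (auto simp: normalization_mapping_def)
  \<comment> \<open>Near all upper bounds \<psi> exceeds \<open>K\<close>. Pinned solutions exist
    with coordinate \<open>z0\<close> arbitrarily close to \<open>U z0\<close>, and pivotality drags
    the other coordinates along.\<close>
  obtain ph where ph: "ph \<in> solutions" "K < \<psi> ph"
  proof -
    have "\<forall>\<^sub>F p in coords_to_upper U UNIV 0. K < \<psi> p"
      using order_tendstoD(1)[OF \<psi>(3) K_in(2)] by simp
    from eventually_coords_to_upper_threshold[OF this bounds]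
    obtain b where b: "\<And>z. b z < U z" and
      bP: "\<And>p. (\<And>z. b z < ereal (p $ z) \<and> ereal (p $ z) < U z) \<Longrightarrow> K < \<psi> p" by auto
    have "\<exists>p\<in>solutions. u < ereal (p $ z0)" if "u < U z0" for u
    proof -
      have "max u (L z0) < U z0" using that bounds by simp
      then obtain x where "max u (L z0) < ereal x" "ereal x < U z0" using ereal_dense2 by blast
      then show ?thesis using ex[of x] by auto
    qed
    from solutions_above[OF up this b] obtain p where p: "p \<in> solutions" "\<And>z. b z < ereal (p $ z)"
      by blast
    then have "K < \<psi> p" by (intro bP) (auto simp: solutions_def open_box_def)
    then show thesis using that p(1) by blast
  qed
  obtain pl where pl: "pl \<in> solutions" "\<psi> pl < K"
  proof -
    have "\<forall>\<^sub>F p in coords_to_lower L UNIV 0. \<psi> p < K"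
      using order_tendstoD(2)[OF \<psi>(2) K_in(1)] by simp
    from eventually_coords_to_lower_threshold[OF this bounds]
    obtain b where b: "\<And>z. L z < b z" and
      bP: "\<And>p. (\<And>z. L z < ereal (p $ z) \<and> ereal (p $ z) < b z) \<Longrightarrow> \<psi> p < K" by auto
    have "\<exists>p\<in>solutions. ereal (p $ z0) < u" if "L z0 < u" for u
    proof -
      have "L z0 < min u (U z0)" using that bounds by simp
      then obtain x where "L z0 < ereal x" "ereal x < min u (U z0)" using ereal_dense2 by blast
      then show ?thesis using ex[of x] by auto
    qed
    from solutions_below[OF down this b] obtain p where p: "p \<in> solutions" "\<And>z. ereal (p $ z) < b z"
      by blast
    then have "\<psi> p < K" by (intro bP) (auto simp: solutions_def open_box_def)
    then show thesis using that p(1) by blast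
  qed
  note pl_range = in_range[OF pl(1)] and ph_range = in_range[OF ph(1)]
  have "pl $ z0 \<le> ph $ z0"
    using \<psi>_mono[OF ph(1) pl(1)] pl(2) ph(2) by (cases "pl $ z0 \<le> ph $ z0") auto
  moreover have "continuous_on {pl $ z0..ph $ z0} (\<lambda>x. \<psi> (ps x))"
    using \<psi>(1) ps_cont[OF pl_range(1) ph_range(2)] by (rule continuous_on_compose2) auto
  \<comment> \<open>The intermediate value theorem applies to \<psi> along the path between the
    coordinates at \<open>z0\<close> of \<open>pl\<close> and \<open>ph\<close>.\<close>
  ultimately obtain x where x: "pl $ z0 \<le> x" "x \<le> ph $ z0" "\<psi> (ps x) = K"
    using IVT'[of "\<lambda>x. \<psi> (ps x)" "pl $ z0" K "ph $ z0"] ps_nth[OF pl(1)] ps_nth[OF ph(1)] pl(2) ph(2)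
    by auto
  have sol_ex: "ps x \<in> solutions" using between[OF pl_range(1) ph_range(2) x(1,2)] ps by blast
  \<comment> \<open>Two solutions with different coordinates at \<open>z0\<close> have different
    values of \<psi>, and equal coordinates there force equality.\<close>
  have sol_unique: "p = p'" if "p \<in> solutions" "\<psi> p = K" "p' \<in> solutions" "\<psi> p' = K" for p p'
    using \<psi>_mono[of p p'] \<psi>_mono[of p' p] that
    by (intro solutions_inj[of p p' z0]) (auto simp: not_less_iff_gr_or_eq intro: linorder_cases)
  have "\<exists>!p. p \<in> ?E \<and> Q p = q \<and> \<psi> p = K"
    using sol_ex x(3) sol_unique unfolding solutions_def by blast
  moreover have "\<exists>lo hi mid. dichotomy_run (L z0) (U z0) ps \<psi> K lo hi mid"
    using pl_range ph_range pl(2) ph(2) ps_nth[OF pl(1)] ps_nth[OF ph(1)]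
    by (intro dichotomy_run_exists[of _ "pl $ z0" _ _ _ _ "ph $ z0"]) auto
  moreover have "(\<lambda>t. ps (mid t)) \<longlonglongrightarrow> p"
    if "p \<in> ?E" "Q p = q" "\<psi> p = K" and run: "dichotomy_run (L z0) (U z0) ps \<psi> K lo hi mid"
    for p lo hi mid
  proof -
    have p: "p \<in> solutions" using that by (simp add: solutions_def)
    have "(\<lambda>t. ps (mid t)) \<longlonglongrightarrow> ps (p $ z0)"
      using dichotomy_run_converges[OF run \<psi>_ps_mono ps_cont in_range[OF p]] ps_nth[OF p] \<open>\<psi> p = K\<close>
      by simp
    then show ?thesis using ps_nth[OF p] by simp
  qed
  ultimately show ?thesis using ex1 unfolding ps_def by blast
qed

end
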